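(* Let $A\in\mathbb{R}^{n\times n}$ and $B\in\mathbb{R}^{m\times m}$ be such that $A$ and $-B$ have no common eigenvalues. Let $A=M_i-N_i$ and $B=P_i-Q_i$ $(i=1,2)$ be splittings such that $M_i\in\mathbb{R}^{n\times n}$ and $P_i\in\mathbb{R}^{m\times m}$ $(i=1,2)$ are symmetric positive definite. Put $\mathcal{A}=I_m\otimes A+B^T\otimes I_n$, and for $i=1,2$ put $\mathcal{M}_i=I_m\otimes M_i+P_i^T\otimes I_n$ and $\mathcal{N}_i=I_m\otimes N_i+Q_i^T\otimes I_n$, so that $\mathcal{A}=\mathcal{M}_i-\mathcal{N}_i$. Assume that $\mathcal{M}_1\mathcal{A}^{-1}$ and $\mathcal{M}_2\mathcal{A}^{-1}$ are Hermitian matrices and that $\mathcal{M}_1\mathcal{A}^{-1}\mathcal{M}_2=\mathcal{M}_2\mathcal{A}^{-1}\mathcal{M}_1$. For $i=1,2$ define $$\theta_i=\sqrt{\frac{\lambda_{\max}(M_i)+\lambda_{\max}(P_i)}{\lambda_{\min}(M_i)+\lambda_{\min}(P_i)}},\qquad \varrho_i=\theta_i^3\,\frac{\max|\lambda(N_i)|+\max|\lambda(Q_i)|}{\lambda_{\min}(M_i)+\lambda_{\min}(P_i)}.$$ If $\varrho_1\varrho_2<1$, then the MSI method for the continuous Sylvester equation $AX+XB=C$ is convergent; that is, for every $C\in\mathbb{R}^{n\times m}$ and every initial guess $X^{(0)}\in\mathbb{R}^{n\times m}$, the MSI iterates $X^{(k)}$ converge to the unique solution $X$ of $AX+XB=C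$.
   Context: $\otimes$ is the Kronecker product, $A\otimes B=[a_{ij}B]$. For a symmetric matrix $M$, $\lambda_{\min}(M)$ and $\lambda_{\max}(M)$ are its minimum and maximum eigenvalues. For a square real matrix $N$, $\max|\lambda(N)|$ is the maximum of the moduli of the (complex) eigenvalues of $N$. Since $A$ and $-B$ have no common eigenvalues, $\mathcal{A}$ is nonsingular and $AX+XB=C$ has a unique solution $X\in\mathbb{R}^{n\times m}$ for every $C\in\mathbb{R}^{n\times m}$. The multiplicative splitting iteration (MSI) method for $AX+XB=C$ with the splittings $A=M_i-N_i$, $B=P_i-Q_i$ $(i=1,2)$ is: given $X^{(0)}\in\mathbb{R}^{n\times m}$, for $k=0,1,2,\dots$ let $U^{(k+1)}$ and then $X^{(k+1)}$ be the unique solutions in $\mathbb{R}^{n\times m}$ of $$M_1U^{(k+1)}+U^{(k+1)}P_1=N_1X^{(k)}+X^{(k)}Q_1+C,$$ $$M_2X^{(k+1)}+X^{(k+1)}P_2=N_2U^{(k+1)}+U^{(k+1)}Q_2+C.$$ (These have unique solutions because $M_i$ and $P_i$ are symmetric positive definite, so $M_i$ and $-P_i$ have no common eigenvalues.) *)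

theory Defs
  imports "HOL-Analysis.Analysis"
begin

definition symmetric_mat :: "real^'n^'n \<Rightarrow> bool" where
  "symmetric_mat M \<longleftrightarrow> transpose M = M"

definition sym_pos_def :: "real^'n^'n \<Rightarrow> bool" where
  "sym_pos_def M \<longleftrightarrow> symmetric_mat M \<and> (\<forall>x. x \<noteq> 0 \<longrightarrow> x \<bullet> (M *v x) > 0)"

definition eigenvalues :: "'a::field^'n^'n \<Rightarrow> 'a set" where
  "eigenvalues M = {c. \<exists>v. v \<noteq> 0 \<and> M *v v = c *s v}"

definition complex_eigenvalues :: "real^'n^'n \<Rightarrow> complex set" where
  "complex_eigenvalues N = eigenvalues (map_matrix complex_of_real N)"

text \<open>
  The extreme eigenvalues are only meant for symmetric matrices: their complex eigenvalues are
  all real, so the real ones form the whole spectrum, a finite nonempty set.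
\<close>

definition lambda_min :: "real^'n^'n \<Rightarrow> real" where
  "lambda_min M = Min (eigenvalues M)"

definition lambda_max :: "real^'n^'n \<Rightarrow> real" where
  "lambda_max M = Max (eigenvalues M)"

definition max_abs_lambda :: "real^'n^'n \<Rightarrow> real" where
  "max_abs_lambda N = Max (cmod ` complex_eigenvalues N)"

text \<open>
  Rows and columns of \<open>A \<otimes> B\<close> are indexed by pairs: the first component selects the block,
  the second the position inside the block.
\<close>

definition kronecker :: "'a::times^'q^'p \<Rightarrow> 'a^'s^'r \<Rightarrow> 'a^('q \<times> 's)^('p \<times> 'r)" where
  "kronecker A B = (\<chi> r c. A $ fst r $ fst c * B $ snd r $ snd c)"

definition sylvester_mat :: "real^'n^'n \<Rightarrow> real^'m^'m \<Rightarrow> real^('m \<times> 'n)^('m \<times> 'n)" where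
  "sylvester_mat A B = kronecker (mat 1 :: real^'m^'m) A + kronecker (transpose B) (mat 1 :: real^'n^'n)"

text \<open>
  The following is meaningful only if \<open>M X + X P = R\<close> has a unique solution, which is the case
  if \<open>M\<close> and \<open>-P\<close> have no common eigenvalues, in particular if both are positive definite.
\<close>

definition sylvester_solution :: "real^'n^'n \<Rightarrow> real^'m^'m \<Rightarrow> real^'m^'n \<Rightarrow> real^'m^'n" where
  "sylvester_solution M P R = (THE X. M ** X + X ** P = R)"

definition msi_half_step ::
  "real^'n^'n \<Rightarrow> real^'n^'n \<Rightarrow> real^'m^'m \<Rightarrow> real^'m^'m \<Rightarrow> real^'m^'n \<Rightarrow> real^'m^'n \<Rightarrow> real^'m^'n"
  where
  "msi_half_step M N P Q C X = sylvester_solution M P (N ** X + X ** Q + C)"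

primrec msi_iterate ::
  "real^'n^'n \<Rightarrow> real^'n^'n \<Rightarrow> real^'m^'m \<Rightarrow> real^'m^'m \<Rightarrow>
   real^'n^'n \<Rightarrow> real^'n^'n \<Rightarrow> real^'m^'m \<Rightarrow> real^'m^'m \<Rightarrow>
   real^'m^'n \<Rightarrow> real^'m^'n \<Rightarrow> nat \<Rightarrow> real^'m^'n"
  where
  "msi_iterate M1 N1 P1 Q1 M2 N2 P2 Q2 C X0 0 = X0"
| "msi_iterate M1 N1 P1 Q1 M2 N2 P2 Q2 C X0 (Suc k) =
     (let U = msi_half_step M1 N1 P1 Q1 C (msi_iterate M1 N1 P1 Q1 M2 N2 P2 Q2 C X0 k)
      in msi_half_step M2 N2 P2 Q2 C U)"

definition msi_theta :: "real^'n^'n \<Rightarrow> real^'m^'m \<Rightarrow> real" where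
  "msi_theta M P = sqrt ((lambda_max M + lambda_max P) / (lambda_min M + lambda_min P))"

definition msi_rho ::
  "real^'n^'n \<Rightarrow> real^'n^'n \<Rightarrow> real^'m^'m \<Rightarrow> real^'m^'m \<Rightarrow> real" where
  "msi_rho M N P Q =
     msi_theta M P ^ 3 * ((max_abs_lambda N + max_abs_lambda Q) / (lambda_min M + lambda_min P))"

end

theory Submission
  imports Defs "HOL-Computational_Algebra.Fundamental_Theorem_Algebra"
begin

text \<open>
  Write \<open>S\<^sub>M\<close> and \<open>S\<^sub>N\<close> for the operators \<open>X \<mapsto> M X + X P\<close> and \<open>X \<mapsto> N X + X Q\<close> of a splitting.
  Symmetry of \<open>S\<^sub>M S\<^sub>A\<^sup>-\<^sup>1\<close> says that \<open>S\<^sub>A\<close>, hence also \<open>S\<^sub>N = S\<^sub>M - S\<^sub>A\<close>, is self-adjoint for the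
  inner product \<open>\<langle>S\<^sub>M X, Y\<rangle>\<close>. The norm of \<open>S\<^sub>N\<close> for that inner product is therefore the modulus
  of an eigenvalue of \<open>S\<^sub>N\<close>, which is a sum of an eigenvalue of \<open>N\<close> and one of \<open>Q\<close>. Passing to the
  Frobenius norm costs a factor \<open>\<theta>\<close>, and \<open>S\<^sub>M\<^sup>-\<^sup>1\<close> has norm at most
  \<open>1 / (\<lambda>\<^sub>m\<^sub>i\<^sub>n(M) + \<lambda>\<^sub>m\<^sub>i\<^sub>n(P))\<close>. Since \<open>\<theta> \<le> \<theta>\<^sup>3\<close>, each half step contracts the error by \<open>\<rho>\<close>.
\<close>

section \<open>Polynomials in a matrix\<close>

text \<open>This is p(A) v evaluated by Horner's scheme; acting on a vector directly keeps matrix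
  powers out of the argument.\<close>

definition poly_vec :: "'a::field^'n^'n \<Rightarrow> 'a poly \<Rightarrow> 'a^'n \<Rightarrow> 'a^'n" where
  "poly_vec A p v = fold_coeffs (\<lambda>a w. a *s v + A *v w) p 0"

lemma poly_vec_0 [simp]: "poly_vec A 0 v = 0"
  by (simp add: poly_vec_def)

lemma poly_vec_pCons [simp]: "poly_vec A (pCons a p) v = a *s v + A *v poly_vec A p v"
proof (cases "p = 0 \<and> a = 0")
  case False
  then show ?thesis
    by (auto simp: poly_vec_def fold_coeffs_pCons_coeff_not_0_eq fold_coeffs_pCons_not_0_0_eq)
qed auto

lemma poly_vec_add: "poly_vec A (p + q) v = poly_vec A p v + poly_vec A q v"
  by (induction p q rule: poly_induct2)
     (simp_all add: matrix_vector_right_distrib vector_sadd_rdistrib algebra_simps)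

lemma poly_vec_smult: "poly_vec A (smult c p) v = c *s poly_vec A p v"
  by (induction p)
     (simp_all add: vec.scale vector_add_ldistrib vector_smult_assoc)

lemma poly_vec_mult: "poly_vec A (p * q) v = poly_vec A p (poly_vec A q v)"
  by (induction p) (simp_all add: poly_vec_add poly_vec_smult)

lemma poly_vec_sum: "poly_vec A (\<Sum>i\<in>I. f i) v = (\<Sum>i\<in>I. poly_vec A (f i) v)"
  by (induction I rule: infinite_finite_induct) (simp_all add: poly_vec_add)

lemma poly_vec_monom: "poly_vec A (monom c k) v = c *s (((*v) A ^^ k) v)"
  by (induction k) (simp_all add: monom_0 monom_Suc vec.scale)

lemma poly_vec_zero_right [simp]: "poly_vec A p 0 = 0"
  by (induction p) simp_all

lemma poly_vec_add_right: "poly_vec A p (v + w) = poly_vec A p v + poly_vec A p w"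
  by (induction p) (simp_all add: matrix_vector_right_distrib vector_add_ldistrib algebra_simps)

lemma poly_vec_scale_right: "poly_vec A p (c *s v) = c *s poly_vec A p v"
  by (induction p) (simp_all add: vec.scale vector_add_ldistrib vector_smult_assoc mult.commute)

lemma poly_vec_sum_right: "poly_vec A p (\<Sum>i\<in>I. f i) = (\<Sum>i\<in>I. poly_vec A p (f i))"
  by (induction I rule: infinite_finite_induct) (simp_all add: poly_vec_add_right)

lemma poly_vec_eigenvector: "A *v v = c *s v \<Longrightarrow> poly_vec A p v = poly p c *s v"
  by (induction p) (simp_all add: vec.scale vector_smult_assoc vector_sadd_rdistrib mult.commute)

lemma poly_vec_intertwine:
  assumes "A ** X = X ** R"
  shows "X *v poly_vec R p v = poly_vec A p (X *v v)"
proof (induction p)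
  case (pCons a p)
  have "X *v (R *v w) = A *v (X *v w)" for w
    by (simp add: matrix_vector_mul_assoc assms)
  then show ?case using pCons by (simp add: matrix_vector_right_distrib vec.scale)
qed simp

text \<open>The Krylov vectors from exponent 0 to n are n + 1 vectors in dimension n; the
  coefficients of a linear dependence among them form the polynomial.\<close>

lemma annihilating_poly_exists:
  fixes A :: "'a::field^'n^'n"
  shows "\<exists>p. p \<noteq> 0 \<and> poly_vec A p v = 0"
proof -
  define w where "w i = ((*v) A ^^ i) v" for i
  let ?I = "{..CARD('n)}"
  show ?thesis
  \<comment> \<open>Dependence is a property of a set, which hides repetitions, so two equal Krylov
    vectors are treated apart.\<close>
  proof (cases "inj_on w ?I")
    case False
    then obtain i j where ij: "i \<noteq> j" "w i = w j" unfolding inj_on_def by blast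
    let ?p = "monom 1 i + monom (-1) j :: 'a poly"
    have "coeff ?p i = 1" using ij by simp
    then have "?p \<noteq> 0" by (metis coeff_0 zero_neq_one)
    moreover have "poly_vec A ?p v = 0"
      using ij(2) by (simp add: poly_vec_add poly_vec_monom flip: w_def vector_sneg_minus1)
    ultimately show ?thesis by blast
  next
    case True
    have "vec.dependent (w ` ?I)"
    proof (rule ccontr)
      assume "vec.independent (w ` ?I)"
      then have "card (w ` ?I) \<le> card (cart_basis :: ('a^'n) set)"
        using vec.independent_span_bound[OF finite_cart_basis, of "w ` ?I"] by auto
      also have "\<dots> = CARD('n)" by (rule card_cart_basis)
      finally show False using True by (simp add: card_image)
    qed
    then obtain u x where u: "x \<in> w ` ?I" "u x \<noteq> 0" "(\<Sum>x\<in>w ` ?I. u x *s x) = 0"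
      by (auto simp: vec.dependent_finite)
    then obtain i where i: "i \<in> ?I" "x = w i" by blast
    let ?p = "\<Sum>i\<in>?I. monom (u (w i)) i"
    have "coeff ?p i = u (w i)" using i by (simp add: coeff_sum)
    then have "?p \<noteq> 0" using u i by (metis coeff_0)
    moreover have "poly_vec A ?p v = 0"
      using u(3) True by (simp add: poly_vec_sum poly_vec_monom sum.reindex flip: w_def)
    ultimately show ?thesis by blast
  qed
qed

text \<open>Polynomials annihilating the single vectors are multiplied; as polynomials commute, the
  fitting factor can act first.\<close>

lemma annihilating_poly_finite:
  fixes A :: "'a::field^'n^'n"
  assumes "finite S"
  shows "\<exists>p. p \<noteq> 0 \<and> (\<forall>v\<in>S. poly_vec A p v = 0)"
  using assms
proof induction
  case empty
  show ?case by (intro exI[of _ 1]) simp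
next
  case (insert x S)
  obtain p where p: "p \<noteq> 0" "\<forall>v\<in>S. poly_vec A p v = 0" using insert by blast
  obtain q where q: "q \<noteq> 0" "poly_vec A q x = 0" using annihilating_poly_exists by blast
  have "poly_vec A (p * q) x = 0" using q by (simp add: poly_vec_mult)
  moreover have "poly_vec A (p * q) v = 0" if "v \<in> S" for v
    using p that by (simp add: poly_vec_mult mult.commute[of p q])
  ultimately show ?case using p q by (intro exI[of _ "p * q"]) auto
qed

section \<open>Eigenvalues as roots of annihilating polynomials\<close>

text \<open>A polynomial that annihilates a basis annihilates every vector, so each eigenvalue is
  one of its finitely many roots. This makes \<open>Min\<close> and \<open>Max\<close> over spectra
  usable.\<close>

lemma finite_eigenvalues:
  fixes A :: "'a::field^'n^'n"
  shows "finite (eigenvalues A)"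
proof -
  obtain p where p: "p \<noteq> 0" "\<forall>v\<in>range (\<lambda>i. axis i 1). poly_vec A p v = 0"
    using annihilating_poly_finite[of "range (\<lambda>i. axis i 1)" A] by auto
  have "poly_vec A p v = 0" for v
  proof -
    have "poly_vec A p v = poly_vec A p (\<Sum>i\<in>UNIV. v $ i *s axis i 1)"
      by (simp add: basis_expansion)
    also have "\<dots> = 0" using p by (simp add: poly_vec_sum_right poly_vec_scale_right)
    finally show ?thesis .
  qed
  then have "eigenvalues A \<subseteq> {c. poly p c = 0}"
    by (auto simp: eigenvalues_def) (metis poly_vec_eigenvector vector_mul_eq_0)
  then show ?thesis using poly_roots_finite[OF p(1)] finite_subset by blast
qed

text \<open>Once the root is divided out, the cofactor has smaller degree, so by minimality it does
  not annihilate \<open>v\<close>; its value at \<open>v\<close> is an eigenvector.\<close>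

lemma root_is_eigenvalue_of_minimal:
  fixes A :: "'a::field^'n^'n"
  assumes "p \<noteq> 0" "poly_vec A p v = 0" "poly p r = 0"
    and min: "\<And>q. q \<noteq> 0 \<Longrightarrow> poly_vec A q v = 0 \<Longrightarrow> degree p \<le> degree q"
  shows "r \<in> eigenvalues A"
proof -
  obtain q where q: "p = [:-r, 1:] * q" using assms(3) by (auto simp: poly_eq_0_iff_dvd)
  then have "q \<noteq> 0" using assms(1) by auto
  then have "degree p = Suc (degree q)" unfolding q by (subst degree_mult_eq) auto
  then have "poly_vec A q v \<noteq> 0" using min \<open>q \<noteq> 0\<close> by force
  moreover have "A *v poly_vec A q v = r *s poly_vec A q v"
    using assms(2) unfolding q poly_vec_mult by (simp add: vec.scale)
  ultimately show ?thesis by (auto simp: eigenvalues_def)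
qed

text \<open>Over the complex numbers linear factors can be stripped one at a time. A nonzero
  constant cannot annihilate \<open>w\<close>, so at some stage the value becomes nonzero, and it is
  an eigenvector for the root just removed.\<close>

lemma annihilating_poly_root_eigenvalue:
  fixes A :: "complex^'n^'n"
  assumes "p \<noteq> 0" "poly_vec A p w = 0" "w \<noteq> 0"
  shows "\<exists>r. poly p r = 0 \<and> r \<in> eigenvalues A"
  using assms
proof (induction "degree p" arbitrary: p)
  case 0
  then obtain a where "p = [:a:]" by (metis degree_eq_zeroE)
  then show ?case using 0 by simp
next
  case (Suc d)
  obtain r where r: "poly p r = 0"
    using fundamental_theorem_of_algebra[of p] Suc.hyps(2) by (auto simp: constant_degree)
  obtain q where q: "p = [:-r, 1:] * q" using r by (auto simp: poly_eq_0_iff_dvd)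
  then have "q \<noteq> 0" using Suc.prems by auto
  then have d: "degree p = Suc (degree q)" unfolding q by (subst degree_mult_eq) auto
  show ?case
  proof (cases "poly_vec A q w = 0")
    case True
    then obtain s where "poly q s = 0" "s \<in> eigenvalues A"
      using Suc.hyps(1)[of q] Suc.hyps(2) d \<open>q \<noteq> 0\<close> assms(3) by auto
    then show ?thesis by (auto simp: q)
  next
    case False
    moreover have "A *v poly_vec A q w = r *s poly_vec A q w"
      using Suc.prems(2) unfolding q poly_vec_mult by (simp add: vec.scale)
    ultimately show ?thesis using r by (auto simp: eigenvalues_def)
  qed
qed

text \<open>
  If \<open>p(R) v = 0\<close> with \<open>p\<close> of minimal degree and \<open>X v \<noteq> 0\<close>, then \<open>p(A) X v = X p(R) v = 0\<close>, so
  some root of \<open>p\<close> is an eigenvalue of \<open>A\<close>, while all roots of \<open>p\<close> are eigenvalues of \<open>R\<close>.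
\<close>
lemma common_eigenvalue_of_intertwined:
  fixes A :: "complex^'n^'n" and R :: "complex^'m^'m" and X :: "complex^'m^'n"
  assumes AX: "A ** X = X ** R" and "X \<noteq> 0"
  shows "eigenvalues A \<inter> eigenvalues R \<noteq> {}"
proof -
  obtain v where v: "X *v v \<noteq> 0"
    using \<open>X \<noteq> 0\<close> by (metis matrix_eq matrix_vector_mult_0)
  define p where "p = (ARG_MIN degree p. p \<noteq> 0 \<and> poly_vec R p v = 0)"
  have p: "p \<noteq> 0 \<and> poly_vec R p v = 0"
    and min: "\<And>q. q \<noteq> 0 \<and> poly_vec R q v = 0 \<Longrightarrow> degree p \<le> degree q"
    using arg_min_nat_lemma[of "\<lambda>p. p \<noteq> 0 \<and> poly_vec R p v = 0" _ degree]
      annihilating_poly_exists[of R v] unfolding p_def by blast+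
  have "poly_vec A p (X *v v) = 0"
    using poly_vec_intertwine[OF AX, of p v] p by simp
  then obtain r where "poly p r = 0" "r \<in> eigenvalues A"
    using annihilating_poly_root_eigenvalue[of p A] p v by blast
  moreover have "r \<in> eigenvalues R"
    using root_is_eigenvalue_of_minimal[of p R v r] p min \<open>poly p r = 0\<close> by blast
  ultimately show ?thesis by blast
qed

section \<open>The Sylvester operator\<close>

definition sylvester_op :: "real^'n^'n \<Rightarrow> real^'m^'m \<Rightarrow> real^'m^'n \<Rightarrow> real^'m^'n" where
  "sylvester_op A B X = A ** X + X ** B"

lemma linear_sylvester_op: "linear (sylvester_op A B)"
  by (rule linearI)
     (simp_all add: sylvester_op_def vec_eq_iff matrix_matrix_mult_def sum.distrib sum_distrib_left
       algebra_simps)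

lemma sylvester_op_diff:
  "sylvester_op (M - N) (P - Q) X = sylvester_op M P X - sylvester_op N Q X"
  by (simp add: sylvester_op_def vec_eq_iff matrix_matrix_mult_def sum_subtractf
      left_diff_distrib right_diff_distrib)

text \<open>Rewritten as \<open>N X = X (\<mu> - Q)\<close>, the equation makes \<open>X\<close>
  intertwine \<open>N\<close> with \<open>\<mu> - Q\<close>, and these then share a complex
  eigenvalue \<open>l\<close>.\<close>

lemma sylvester_eigenvalue:
  fixes N :: "real^'n^'n" and Q :: "real^'m^'m" and X :: "real^'m^'n"
  assumes eq: "sylvester_op N Q X = \<mu> *\<^sub>R X" and "X \<noteq> 0"
  obtains l where "l \<in> complex_eigenvalues N" "of_real \<mu> - l \<in> complex_eigenvalues Q"
proof -
  let ?N = "map_matrix complex_of_real N" and ?Q = "map_matrix complex_of_real Q"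
    and ?X = "\<chi> i j. complex_of_real (X $ i $ j)"
  have "?N ** ?X = ?X ** (mat (of_real \<mu>) - ?Q)"
  proof -
    have "(?N ** ?X) $ i $ j = (?X ** (mat (of_real \<mu>) - ?Q)) $ i $ j" for i j
    proof -
      have "(\<Sum>k\<in>UNIV. N $ i $ k * X $ k $ j) + (\<Sum>k\<in>UNIV. X $ i $ k * Q $ k $ j) = \<mu> * X $ i $ j"
        using arg_cong[OF eq, of "\<lambda>Y. Y $ i $ j"]
        by (simp add: sylvester_op_def matrix_matrix_mult_def)
      from arg_cong[OF this, of complex_of_real] show ?thesis
        by (simp add: matrix_matrix_mult_def map_matrix_def mat_def right_diff_distrib
            sum_subtractf if_distrib[of "\<lambda>x. _ * x"] eq_diff_eq mult.commute cong: if_cong)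
    qed
    then show ?thesis by (simp add: vec_eq_iff)
  qed
  moreover have "?X \<noteq> 0" using \<open>X \<noteq> 0\<close> by (auto simp: vec_eq_iff)
  ultimately obtain l where l: "l \<in> eigenvalues ?N" "l \<in> eigenvalues (mat (of_real \<mu>) - ?Q)"
    using common_eigenvalue_of_intertwined by blast
  from l(2) obtain v where v: "v \<noteq> 0" "(mat (of_real \<mu>) - ?Q) *v v = l *s v"
    by (auto simp: eigenvalues_def)
  have "mat (of_real \<mu>) *v v = complex_of_real \<mu> *s v"
    by (simp add: vec_eq_iff matrix_vector_mult_def mat_def if_distrib[of "\<lambda>x. x * _"] cong: if_cong)
  then have "?Q *v v = (of_real \<mu> - l) *s v"
    using v(2) by (simp add: matrix_vector_mult_diff_rdistrib vector_sub_rdistrib algebra_simps)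
  then have "of_real \<mu> - l \<in> eigenvalues ?Q" using v(1) by (auto simp: eigenvalues_def)
  then show ?thesis using that l(1) by (auto simp: complex_eigenvalues_def)
qed

lemma sylvester_eigenvalue_le:
  assumes "sylvester_op N Q X = \<mu> *\<^sub>R X" and "X \<noteq> 0"
  shows "\<bar>\<mu>\<bar> \<le> max_abs_lambda N + max_abs_lambda Q"
proof -
  obtain l where l: "l \<in> complex_eigenvalues N" "of_real \<mu> - l \<in> complex_eigenvalues Q"
    using sylvester_eigenvalue[OF assms] .
  have le: "cmod c \<le> max_abs_lambda K" if "c \<in> complex_eigenvalues K" for c and K :: "real^'k^'k"
    unfolding max_abs_lambda_def
    using that finite_eigenvalues by (intro Max_ge) (auto simp: complex_eigenvalues_def)
  have "\<bar>\<mu>\<bar> = cmod (l + (of_real \<mu> - l))" by simp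
  also have "\<dots> \<le> cmod l + cmod (of_real \<mu> - l)" by (rule norm_triangle_ineq)
  finally show ?thesis using le[OF l(1)] le[OF l(2)] by simp
qed

lemma linear_injective_ex1:
  fixes f :: "'a::euclidean_space \<Rightarrow> 'a"
  assumes "linear f" "\<And>x. f x = 0 \<Longrightarrow> x = 0"
  shows "\<exists>!x. f x = y"
proof -
  have "inj f" using assms linear_injective_0 by blast
  then show ?thesis using linear_injective_imp_surjective[OF assms(1)]
    by (metis surj_def injD)
qed

lemma matrix_vector_mult_minus_left: "- A *v x = - (A *v (x :: 'a::ring_1^'n))"
  by (simp add: vec_eq_iff matrix_vector_mult_def sum_negf)

text \<open>A nonzero kernel element is an eigenvector for \<mu> = 0, and the splitting
  \<open>0 = l + (- l)\<close> puts \<open>l\<close> in the spectra of both \<open>A\<close> and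
  \<open>- B\<close>.\<close>

lemma sylvester_op_eq_0:
  assumes "complex_eigenvalues A \<inter> complex_eigenvalues (- B) = {}" "sylvester_op A B X = 0"
  shows "X = 0"
proof (rule ccontr)
  assume "X \<noteq> 0"
  then obtain l where l: "l \<in> complex_eigenvalues A" "- l \<in> complex_eigenvalues B"
    using sylvester_eigenvalue[of A B X 0] assms(2) by auto
  have "map_matrix complex_of_real (- B) = - map_matrix complex_of_real B"
    by (simp add: vec_eq_iff map_matrix_def)
  moreover obtain v where "v \<noteq> 0" "map_matrix complex_of_real B *v v = - l *s v"
    using l(2) by (auto simp: complex_eigenvalues_def eigenvalues_def)
  ultimately have "l \<in> complex_eigenvalues (- B)"
    by (auto simp: complex_eigenvalues_def eigenvalues_def matrix_vector_mult_minus_left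
        vector_smult_lneg intro!: exI[of _ v])
  then show False using l assms(1) by blast
qed

section \<open>Rayleigh quotients\<close>

text \<open>The form attains its minimum 0 at \<open>x\<close>, so its derivative there in direction
  \<open>h x\<close> vanishes; that derivative is twice the squared norm of
  \<open>h x\<close>.\<close>

lemma psd_zero:
  fixes h :: "'a::real_inner \<Rightarrow> 'a"
  assumes "linear h" and sa: "\<And>x y. h x \<bullet> y = x \<bullet> h y" and psd: "\<And>x. h x \<bullet> x \<ge> 0"
    and x: "h x \<bullet> x = 0"
  shows "h x = 0"
proof (rule ccontr)
  assume "h x \<noteq> 0"
  let ?y = "h x" and ?b = "h (h x) \<bullet> h x"
  have pos: "?y \<bullet> ?y > 0" using \<open>h x \<noteq> 0\<close> by simp
  have q: "0 \<le> 2 * t * (?y \<bullet> ?y) + t^2 * ?b" for t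
    using psd[of "x + t *\<^sub>R ?y"] x sa[of ?y x]
    by (simp add: linear_add[OF assms(1)] linear_scale[OF assms(1)] inner_add_left inner_add_right
        power2_eq_square algebra_simps)
  have b: "?b \<ge> 0" by (rule psd)
  \<comment> \<open>The step length keeps the quadratic term below the linear one; adding 1 avoids
    division by zero when \<open>?b = 0\<close>.\<close>
  define s where "s = 1 / (?b + 1)"
  have s: "s > 0" "s * ?b = 1 - s" using b by (auto simp: s_def field_simps)
  let ?t = "- (?y \<bullet> ?y) * s"
  have "2 * ?t * (?y \<bullet> ?y) + ?t^2 * ?b = (?y \<bullet> ?y)^2 * s * (s * ?b - 2)"
    by (simp add: power2_eq_square algebra_simps)
  also have "\<dots> < 0" unfolding s(2) using s(1) pos by (intro mult_pos_neg) auto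
  finally show False using q[of ?t] by simp
qed

text \<open>At a maximiser of the quotient on the unit sphere, \<open>\<mu> g - f\<close> is
  positive semidefinite with vanishing form, so \<open>psd_zero\<close> yields the generalised
  eigenvalue equation.\<close>

lemma rayleigh_max:
  fixes f g :: "'a::euclidean_space \<Rightarrow> 'a"
  assumes "linear f" "linear g"
    and f: "\<And>x y. f x \<bullet> y = x \<bullet> f y" and g: "\<And>x y. g x \<bullet> y = x \<bullet> g y"
    and pos: "\<And>x. x \<noteq> 0 \<Longrightarrow> g x \<bullet> x > 0"
  obtains x \<mu> where "x \<noteq> 0" "f x = \<mu> *\<^sub>R g x" "\<And>y. f y \<bullet> y \<le> \<mu> * (g y \<bullet> y)"
proof -
  let ?q = "\<lambda>x. (f x \<bullet> x) / (g x \<bullet> x)"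
  have "\<forall>x\<in>sphere 0 1. g x \<bullet> x \<noteq> 0"
    using pos by (metis less_irrefl mem_sphere_0 norm_zero zero_neq_one)
  then have "continuous_on (sphere 0 1) ?q"
    by (intro continuous_intros linear_continuous_on_compose[OF _ assms(1)]
        linear_continuous_on_compose[OF _ assms(2)])
  then obtain x where x: "x \<in> sphere 0 1" "\<And>y. y \<in> sphere 0 1 \<Longrightarrow> ?q y \<le> ?q x"
    using continuous_attains_sup[of "sphere 0 1" ?q] by (auto simp: sphere_eq_empty)
  define \<mu> where "\<mu> = ?q x"
  have x0: "x \<noteq> 0" using x(1) by auto
  have le: "f y \<bullet> y \<le> \<mu> * (g y \<bullet> y)" for y
  proof (cases "y = 0")
    case False
    let ?z = "y /\<^sub>R norm y"
    have "?q ?z \<le> \<mu>" unfolding \<mu>_def using False by (intro x(2)) simp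
    moreover have "?q ?z = ?q y"
      using False by (simp add: linear_scale[OF assms(1)] linear_scale[OF assms(2)])
    ultimately show ?thesis using pos[OF False] by (simp add: divide_le_eq)
  qed (simp add: linear_0[OF assms(1)])
  let ?h = "\<lambda>y. \<mu> *\<^sub>R g y - f y"
  have "?h x = 0"
  proof (rule psd_zero[of ?h x])
    show "linear ?h" using assms(1,2) by (intro linear_compose_sub linear_compose_scale_right)
    show "?h x \<bullet> x = 0"
      using pos[OF x0] by (simp add: \<mu>_def inner_diff_left)
  qed (use le f g in \<open>simp_all add: inner_diff_left inner_diff_right\<close>)
  then show ?thesis using that[OF x0 _ le] by simp
qed

section \<open>Extreme eigenvalues of symmetric matrices\<close>

lemma symmetric_matD: "symmetric_mat M \<Longrightarrow> (M *v x) \<bullet> y = x \<bullet> (M *v y)"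
  by (metis symmetric_mat_def dot_lmul_matrix vector_transpose_matrix)

lemma eigenvalues_real_iff:
  "c \<in> eigenvalues (M :: real^'n^'n) \<longleftrightarrow> (\<exists>v. v \<noteq> 0 \<and> M *v v = c *\<^sub>R v)"
  by (simp add: eigenvalues_def scalar_mult_eq_scaleR)

lemma lambda_max_ge:
  assumes "symmetric_mat (M :: real^'n^'n)"
  shows "(M *v y) \<bullet> y \<le> lambda_max M * (y \<bullet> y)"
proof -
  obtain x \<mu> where x: "x \<noteq> 0" "M *v x = \<mu> *\<^sub>R x" "\<And>y. (M *v y) \<bullet> y \<le> \<mu> * (y \<bullet> y)"
    by (rule rayleigh_max[of "(*v) M" "\<lambda>x. x"])
       (use symmetric_matD[OF assms] matrix_vector_mul_linear[of M] linear_ident in simp_all)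
  then have "\<mu> \<le> lambda_max M" unfolding lambda_max_def
    by (intro Max_ge finite_eigenvalues) (auto simp: eigenvalues_real_iff)
  then show ?thesis using x(3)[of y] by (meson inner_ge_zero mult_right_mono order_trans)
qed

lemma eigenvalues_uminus: "c \<in> eigenvalues (- M) \<longleftrightarrow> - c \<in> eigenvalues (M :: real^'n^'n)"
proof -
  have "- M *v v = c *\<^sub>R v \<longleftrightarrow> M *v v = - c *\<^sub>R v" for v
    by (metis add.inverse_inverse matrix_vector_mult_minus_left scaleR_minus_left)
  then show ?thesis by (simp add: eigenvalues_real_iff)
qed

text \<open>The largest Rayleigh quotient of \<open>- M\<close>, negated, is an eigenvalue of
  \<open>M\<close> that bounds the form below. It also shows that the spectrum is nonempty, so that
  \<open>Min\<close> is attained.\<close>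

lemma lambda_min_le:
  assumes "symmetric_mat (M :: real^'n^'n)"
  shows "lambda_min M * (y \<bullet> y) \<le> (M *v y) \<bullet> y"
    and "lambda_min M \<in> eigenvalues M"
proof -
  have sa: "(- M *v x) \<bullet> y = x \<bullet> (- M *v y)" for x y
    using symmetric_matD[OF assms] by (simp add: matrix_vector_mult_minus_left)
  obtain x \<mu> where x: "x \<noteq> 0" "- M *v x = \<mu> *\<^sub>R x" "\<And>y. (- M *v y) \<bullet> y \<le> \<mu> * (y \<bullet> y)"
    by (rule rayleigh_max[of "(*v) (- M)" "\<lambda>x. x"])
       (use sa matrix_vector_mul_linear[of "- M"] linear_ident in simp_all)
  then have mem: "- \<mu> \<in> eigenvalues M"
    using eigenvalues_real_iff[of \<mu> "- M"] by (auto simp: eigenvalues_uminus)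
  then have "lambda_min M \<le> - \<mu>" unfolding lambda_min_def
    by (intro Min_le finite_eigenvalues)
  then have "lambda_min M * (y \<bullet> y) \<le> - \<mu> * (y \<bullet> y)" by (intro mult_right_mono) auto
  then show "lambda_min M * (y \<bullet> y) \<le> (M *v y) \<bullet> y" using x(3)[of y]
    by (simp add: matrix_vector_mult_minus_left)
  show "lambda_min M \<in> eigenvalues M"
    unfolding lambda_min_def using mem finite_eigenvalues by (intro Min_in) auto
qed

lemma lambda_min_pos:
  assumes "sym_pos_def M"
  shows "lambda_min M > 0"
proof -
  obtain v where v: "v \<noteq> 0" "M *v v = lambda_min M *\<^sub>R v"
    using lambda_min_le(2)[of M] assms by (auto simp: eigenvalues_real_iff sym_pos_def_def)
  then have "lambda_min M * (v \<bullet> v) > 0"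
    using assms by (metis sym_pos_def_def inner_scaleR_right)
  then show ?thesis using inner_ge_zero[of v] by (simp add: zero_less_mult_iff)
qed

lemma lambda_min_le_max:
  assumes "symmetric_mat M"
  shows "lambda_min M \<le> lambda_max M"
  unfolding lambda_max_def by (rule Max_ge[OF finite_eigenvalues lambda_min_le(2)[OF assms]])


section \<open>Transfer to the Kronecker form\<close>

text \<open>The first index is the column, so the columns of \<open>X\<close> are stacked, in
  agreement with the block convention of \<open>kronecker\<close>.\<close>

definition vectorize :: "real^'m^'n \<Rightarrow> real^('m \<times> 'n)" where
  "vectorize X = (\<chi> p. X $ snd p $ fst p)"

lemma surj_vectorize: "surj (vectorize :: real^'m^'n \<Rightarrow> _)"
proof (rule surjI)
  show "vectorize (\<chi> i j. x $ (j, i)) = x" for x :: "real^('m::finite \<times> 'n::finite)"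
    by (simp add: vectorize_def vec_eq_iff)
qed

lemma vectorize_eq_0: "vectorize X = 0 \<Longrightarrow> X = 0"
  by (simp add: vectorize_def vec_eq_iff)

lemma inner_vectorize: "vectorize X \<bullet> vectorize Y = X \<bullet> Y"
proof -
  have "vectorize X \<bullet> vectorize Y = (\<Sum>j\<in>UNIV. \<Sum>i\<in>UNIV. X $ i $ j * Y $ i $ j)"
    by (simp add: inner_vec_def vectorize_def sum.cartesian_product case_prod_beta)
  also have "\<dots> = X \<bullet> Y" by (subst sum.swap) (simp add: inner_vec_def)
  finally show ?thesis .
qed

lemma sylvester_mat_vectorize:
  "sylvester_mat A B *v vectorize X = vectorize (sylvester_op A B X)"
proof -
  have "(sylvester_mat A B *v vectorize X) $ p = vectorize (sylvester_op A B X) $ p" for p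
  proof -
    \<comment> \<open>The identity factors of the Kronecker products turn into Kronecker deltas,
      each of which collapses one of the two sums.\<close>
    have "(sylvester_mat A B *v vectorize X) $ p
        = (\<Sum>j\<in>UNIV. \<Sum>i\<in>UNIV. ((if fst p = j then A $ snd p $ i else 0)
              + (if snd p = i then B $ j $ fst p else 0)) * X $ i $ j)"
      by (simp add: sylvester_mat_def kronecker_def matrix_vector_mult_def vectorize_def mat_def
          transpose_def sum.cartesian_product case_prod_beta UNIV_Times_UNIV if_distrib[of "\<lambda>x. x * _"]
          if_distrib[of "\<lambda>x. _ * x"] cong: if_cong)
    also have "\<dots> = (\<Sum>i\<in>UNIV. \<Sum>j\<in>UNIV. if fst p = j then A $ snd p $ i * X $ i $ j else 0)
         + (\<Sum>j\<in>UNIV. \<Sum>i\<in>UNIV. if snd p = i then B $ j $ fst p * X $ i $ j else 0)"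
      by (subst (2) sum.swap)
         (simp add: distrib_right sum.distrib if_distrib[of "\<lambda>x. x * _"] cong: if_cong)
    also have "\<dots> = vectorize (sylvester_op A B X) $ p"
      by (simp add: vectorize_def sylvester_op_def matrix_matrix_mult_def mult.commute)
    finally show ?thesis .
  qed
  then show ?thesis by (simp add: vec_eq_iff)
qed

section \<open>Quadratic forms of Sylvester operators\<close>

text \<open>The left factor acts on columns, and by symmetry \<open>P\<close> acts on rows as if
  from the left. Rayleigh bounds for \<open>M\<close> and \<open>P\<close> can then be summed over
  columns and rows.\<close>

lemma inner_sylvester_op:
  assumes "symmetric_mat P"
  shows "sylvester_op M P X \<bullet> Y
    = (\<Sum>j\<in>UNIV. (M *v column j X) \<bullet> column j Y) + (\<Sum>i\<in>UNIV. (P *v X $ i) \<bullet> Y $ i)"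
proof -
  have "(M ** X) \<bullet> Y = (\<Sum>j\<in>UNIV. (M *v column j X) \<bullet> column j Y)"
    unfolding inner_vec_def
    by (subst sum.swap) (simp add: matrix_matrix_mult_def matrix_vector_mult_def column_def)
  moreover have "(X ** P) $ i = P *v X $ i" for i
  proof -
    have "P $ k $ j = P $ j $ k" for j k
      using arg_cong[OF assms[unfolded symmetric_mat_def], of "\<lambda>Z. Z $ j $ k"]
      by (simp add: transpose_def)
    then show ?thesis
      by (simp add: vec_eq_iff matrix_matrix_mult_def matrix_vector_mult_def mult.commute)
  qed
  ultimately show ?thesis
    by (simp add: sylvester_op_def inner_add_left inner_vec_def[of "X ** P"])
qed

lemma sylvester_op_self_adjoint:
  assumes "symmetric_mat M" "symmetric_mat P"
  shows "sylvester_op M P X \<bullet> Y = X \<bullet> sylvester_op M P Y"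
proof -
  have M: "(M *v x) \<bullet> y = (M *v y) \<bullet> x" for x y
    using symmetric_matD[OF assms(1)] by (metis inner_commute)
  have P: "(P *v x) \<bullet> y = (P *v y) \<bullet> x" for x y
    using symmetric_matD[OF assms(2)] by (metis inner_commute)
  show ?thesis
    unfolding inner_commute[of X] inner_sylvester_op[OF assms(2)]
    by (intro arg_cong2[where f = "(+)"] sum.cong refl M P)
qed

lemma inner_columns: "X \<bullet> X = (\<Sum>j\<in>UNIV. column j X \<bullet> column j (X :: real^'m^'n))"
  unfolding inner_vec_def by (subst sum.swap) (simp add: column_def)

lemma sylvester_op_ge:
  assumes "symmetric_mat M" "symmetric_mat P"
  shows "(lambda_min M + lambda_min P) * (X \<bullet> X) \<le> sylvester_op M P X \<bullet> X"
proof -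
  have "lambda_min M * (X \<bullet> X) \<le> (\<Sum>j\<in>UNIV. (M *v column j X) \<bullet> column j X)"
    unfolding inner_columns sum_distrib_left by (intro sum_mono lambda_min_le assms)
  moreover have "lambda_min P * (X \<bullet> X) \<le> (\<Sum>i\<in>UNIV. (P *v X $ i) \<bullet> X $ i)"
    unfolding inner_vec_def[of X] sum_distrib_left by (intro sum_mono lambda_min_le assms)
  ultimately show ?thesis by (simp add: inner_sylvester_op[OF assms(2)] distrib_right)
qed

lemma sylvester_op_le:
  assumes "symmetric_mat M" "symmetric_mat P"
  shows "sylvester_op M P X \<bullet> X \<le> (lambda_max M + lambda_max P) * (X \<bullet> X)"
proof -
  have "(\<Sum>j\<in>UNIV. (M *v column j X) \<bullet> column j X) \<le> lambda_max M * (X \<bullet> X)"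
    unfolding inner_columns sum_distrib_left by (intro sum_mono lambda_max_ge assms)
  moreover have "(\<Sum>i\<in>UNIV. (P *v X $ i) \<bullet> X $ i) \<le> lambda_max P * (X \<bullet> X)"
    unfolding inner_vec_def[of X] sum_distrib_left by (intro sum_mono lambda_max_ge assms)
  ultimately show ?thesis by (simp add: inner_sylvester_op[OF assms(2)] distrib_right)
qed

lemma sylvester_op_pos:
  assumes "sym_pos_def M" "sym_pos_def P" "X \<noteq> 0"
  shows "sylvester_op M P X \<bullet> X > 0"
proof -
  have "0 < (lambda_min M + lambda_min P) * (X \<bullet> X)"
    using assms lambda_min_pos[of M] lambda_min_pos[of P] by (intro mult_pos_pos) auto
  also have "\<dots> \<le> sylvester_op M P X \<bullet> X"
    using assms by (intro sylvester_op_ge) (auto simp: sym_pos_def_def)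
  finally show ?thesis .
qed

section \<open>Self-adjointness in the energy inner product\<close>

text \<open>Symmetry of \<open>?H\<close> is tested on the images of \<open>X\<close> and
  \<open>Y\<close> under \<open>sylvester_op A B\<close>, where the inverse cancels. For symmetric
  \<open>M\<close> and \<open>P\<close> this is self-adjointness in the product given by
  \<open>sylvester_op M P\<close>.\<close>

lemma sylvester_op_inner_swap:
  assumes disj: "complex_eigenvalues A \<inter> complex_eigenvalues (- B) = {}"
    and sym: "symmetric_mat (sylvester_mat M P ** matrix_inv (sylvester_mat A B))"
  shows "sylvester_op M P X \<bullet> sylvester_op A B Y = sylvester_op A B X \<bullet> sylvester_op M P Y"
proof -
  let ?A = "sylvester_mat A B"
  let ?H = "sylvester_mat M P ** matrix_inv ?A"
  \<comment> \<open>The disjoint spectra make the kernel trivial, so that \<open>matrix_inv\<close>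
    gives a true inverse.\<close>
  have "x = 0" if "?A *v x = 0" for x
  proof -
    obtain X where "x = vectorize X" using surj_vectorize by blast
    then show ?thesis using that sylvester_op_eq_0[OF disj] vectorize_eq_0
      by (metis sylvester_mat_vectorize matrix_vector_mult_0_right)
  qed
  then have "invertible ?A"
    by (simp add: invertible_left_inverse matrix_left_invertible_ker)
  then have "matrix_inv ?A ** ?A = mat 1"
    unfolding invertible_def matrix_inv_def by (rule someI2_ex) simp
  then have "?H ** ?A = sylvester_mat M P"
    by (metis matrix_mul_assoc matrix_mul_rid)
  then have H: "?H *v vectorize (sylvester_op A B Z) = vectorize (sylvester_op M P Z)" for Z
    by (metis sylvester_mat_vectorize matrix_vector_mul_assoc)
  show ?thesis
    using symmetric_matD[OF sym, of "vectorize (sylvester_op A B X)" "vectorize (sylvester_op A B Y)"]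
    by (simp add: H inner_vectorize)
qed

text \<open>Maximising the Rayleigh quotient of the square of \<open>?N\<close> controls both ends
  of the spectrum of \<open>?N\<close> at once; the square root of the maximum is the modulus of an
  eigenvalue of \<open>?N\<close>.\<close>

lemma sylvester_op_square_bound:
  assumes M: "sym_pos_def M" and P: "sym_pos_def P"
    and sa: "\<And>X Y. sylvester_op M P (sylvester_op N Q X) \<bullet> Y = X \<bullet> sylvester_op M P (sylvester_op N Q Y)"
  shows "max_abs_lambda N + max_abs_lambda Q \<ge> 0"
    and "sylvester_op M P (sylvester_op N Q Y) \<bullet> sylvester_op N Q Y
      \<le> (max_abs_lambda N + max_abs_lambda Q)\<^sup>2 * (sylvester_op M P Y \<bullet> Y)"
proof -
  let ?M = "sylvester_op M P" and ?N = "sylvester_op N Q"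
  let ?s = "max_abs_lambda N + max_abs_lambda Q"
  have saM: "?M X \<bullet> Y = X \<bullet> ?M Y" for X Y
    using sylvester_op_self_adjoint M P by (auto simp: sym_pos_def_def)
  \<comment> \<open>One \<open>?N\<close> crosses to the other side, so the form of
    \<open>?M ?N ?N\<close> at \<open>Y\<close> is the energy of \<open>?N Y\<close>.\<close>
  have MN: "?M (?N (?N X)) \<bullet> Y = ?M (?N X) \<bullet> ?N Y" for X Y
    by (metis sa saM)
  have posM: "?M X \<bullet> X > 0" if "X \<noteq> 0" for X
    using sylvester_op_pos[OF M P that] .
  have linN: "linear ?N" by (rule linear_sylvester_op)
  obtain X \<mu> where X: "X \<noteq> 0" "?M (?N (?N X)) = \<mu> *\<^sub>R ?M X"
    and le: "\<And>Y. ?M (?N (?N Y)) \<bullet> Y \<le> \<mu> * (?M Y \<bullet> Y)"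
  proof (rule rayleigh_max[of "\<lambda>X. ?M (?N (?N X))" ?M])
    show "linear (\<lambda>X. ?M (?N (?N X)))"
      using linear_compose[OF linear_compose[OF linN linN] linear_sylvester_op[of M P]]
      by (simp add: o_def)
    show "?M (?N (?N X)) \<bullet> Y = X \<bullet> ?M (?N (?N Y))" for X Y
      by (metis MN saM inner_commute)
  qed (use linear_sylvester_op saM posM in auto)
  \<comment> \<open>Being positive definite, \<open>?M\<close> can be cancelled, which leaves an
    ordinary eigenvector of the squared operator.\<close>
  have "?M (?N (?N X) - \<mu> *\<^sub>R X) = 0"
    using X(2) by (simp add: linear_diff[OF linear_sylvester_op] linear_scale[OF linear_sylvester_op])
  then have NN: "?N (?N X) = \<mu> *\<^sub>R X"
    using posM[of "?N (?N X) - \<mu> *\<^sub>R X"] by fastforce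
  have "\<mu> \<ge> 0"
  proof -
    have "0 \<le> ?M (?N X) \<bullet> ?N X" using posM[of "?N X"]
      by (cases "?N X = 0") (auto simp: linear_0[OF linear_sylvester_op])
    also have "\<dots> = \<mu> * (?M X \<bullet> X)" using X(2) MN[of X X] by simp
    finally show ?thesis using posM[OF X(1)] by (simp add: zero_le_mult_iff)
  qed
  define r where "r = sqrt \<mu>"
  have r: "r \<ge> 0" "\<mu> = r * r" using \<open>\<mu> \<ge> 0\<close> by (auto simp: r_def)
  \<comment> \<open>\<open>(S\<^sub>N - r) (S\<^sub>N + r) X = 0\<close>\<close>
  have "\<exists>Z t. Z \<noteq> 0 \<and> ?N Z = t *\<^sub>R Z \<and> \<bar>t\<bar> = r"
  proof (cases "?N X = r *\<^sub>R X")
    case True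
    then show ?thesis using X(1) r by auto
  next
    case False
    have "?N (?N X - r *\<^sub>R X) = (- r) *\<^sub>R (?N X - r *\<^sub>R X)"
      using r by (simp add: linear_diff[OF linN] linear_scale[OF linN] NN algebra_simps)
    then show ?thesis using False r by (intro exI[of _ "?N X - r *\<^sub>R X"] exI[of _ "-r"]) auto
  qed
  then have "r \<le> ?s" using sylvester_eigenvalue_le by metis
  then show "?s \<ge> 0" using r by simp
  have "\<mu> \<le> ?s\<^sup>2" using \<open>r \<le> ?s\<close> r by (simp add: power2_eq_square mult_mono)
  moreover have "?M Y \<bullet> Y \<ge> 0"
    using posM[of Y] by (cases "Y = 0") auto
  ultimately have "\<mu> * (?M Y \<bullet> Y) \<le> ?s\<^sup>2 * (?M Y \<bullet> Y)" by (rule mult_right_mono)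
  then show "?M (?N Y) \<bullet> ?N Y \<le> ?s\<^sup>2 * (?M Y \<bullet> Y)" using le[of Y] MN[of Y Y] by simp
qed

section \<open>Convergence\<close>

text \<open>Here \<open>Y\<close> and \<open>Z\<close> stand for the errors before and after a half
  step. Nonnegativity of the factor is recorded because chaining half steps multiplies inequalities
  by it.\<close>

lemma splitting_contraction:
  assumes disj: "complex_eigenvalues A \<inter> complex_eigenvalues (- B) = {}"
    and A: "A = M - N" and B: "B = P - Q"
    and M: "sym_pos_def M" and P: "sym_pos_def P"
    and sym: "symmetric_mat (sylvester_mat M P ** matrix_inv (sylvester_mat A B))"
  shows "msi_rho M N P Q \<ge> 0"
    and "sylvester_op M P Z = sylvester_op N Q Y \<Longrightarrow> norm Z \<le> msi_rho M N P Q * norm Y"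
proof -
  let ?M = "sylvester_op M P" and ?N = "sylvester_op N Q"
  let ?s = "max_abs_lambda N + max_abs_lambda Q"
  define a where "a = lambda_min M + lambda_min P"
  define b where "b = lambda_max M + lambda_max P"
  define \<theta> where "\<theta> = msi_theta M P"
  have symM: "symmetric_mat M" and symP: "symmetric_mat P"
    using M P by (auto simp: sym_pos_def_def)
  have a: "a > 0" unfolding a_def using lambda_min_pos[OF M] lambda_min_pos[OF P] by simp
  have ab: "a \<le> b" unfolding a_def b_def
    using lambda_min_le_max[OF symM] lambda_min_le_max[OF symP] by simp
  have \<theta>: "\<theta> \<ge> 1" "\<theta>\<^sup>2 = b / a"
    using a ab by (auto simp: \<theta>_def msi_theta_def a_def b_def)
  have N: "?N X = ?M X - sylvester_op A B X" for X
    unfolding A B by (simp add: sylvester_op_diff)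
  have saM: "?M X \<bullet> Y = X \<bullet> ?M Y" for X Y
    using sylvester_op_self_adjoint[OF symM symP] .
  \<comment> \<open>The term \<open>?M X \<bullet> ?M Y\<close> is common to both sides, so the swap
    rule for \<open>sylvester_op A B\<close> passes to the difference \<open>?N\<close>.\<close>
  have "?M (?N X) \<bullet> Y = X \<bullet> ?M (?N Y)" for X Y
  proof -
    have "?M (?N X) \<bullet> Y = ?N X \<bullet> ?M Y" by (rule saM)
    also have "\<dots> = ?M X \<bullet> ?M Y - sylvester_op A B X \<bullet> ?M Y"
      by (simp only: N inner_diff_left)
    also have "\<dots> = ?M X \<bullet> ?N Y"
      using sylvester_op_inner_swap[OF disj sym, of X Y] by (simp only: N inner_diff_right)
    finally show ?thesis by (simp only: saM[of X])
  qed
  note bound = sylvester_op_square_bound[OF M P this]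
  have s: "?s \<ge> 0" by (rule bound(1))
  show "msi_rho M N P Q \<ge> 0"
    using s a \<theta>(1) by (simp add: msi_rho_def flip: \<theta>_def a_def)
  show "norm Z \<le> msi_rho M N P Q * norm Y" if eq: "?M Z = ?N Y"
  proof -
    \<comment> \<open>Passing to the energy norm and back costs \<open>b / a\<close>, the square of
      \<open>\<theta>\<close>.\<close>
    have "a * (norm (?N Y))\<^sup>2 \<le> ?M (?N Y) \<bullet> ?N Y"
      using sylvester_op_ge[OF symM symP] by (simp add: a_def power2_norm_eq_inner)
    also have "\<dots> \<le> ?s\<^sup>2 * (?M Y \<bullet> Y)" by (rule bound(2))
    also have "\<dots> \<le> ?s\<^sup>2 * (b * (norm Y)\<^sup>2)"
      using sylvester_op_le[OF symM symP]
      by (intro mult_left_mono) (auto simp: b_def power2_norm_eq_inner)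
    finally have "(norm (?N Y))\<^sup>2 \<le> ?s\<^sup>2 * (b * (norm Y)\<^sup>2) / a"
      using a by (simp add: pos_le_divide_eq mult.commute)
    also have "\<dots> = (?s * \<theta> * norm Y)\<^sup>2"
      by (simp only: power_mult_distrib \<theta>(2) times_divide_eq_left times_divide_eq_right mult.assoc)
    finally have "(norm (?N Y))\<^sup>2 \<le> (?s * \<theta> * norm Y)\<^sup>2" .
    then have Nle: "norm (?N Y) \<le> ?s * \<theta> * norm Y"
      by (rule power2_le_imp_le) (use s \<theta>(1) in auto)
    \<comment> \<open>Coercivity of \<open>?M\<close> together with Cauchy-Schwarz bounds the
      inverse of \<open>?M\<close> by \<open>1 / a\<close>.\<close>
    have "a * (norm Z * norm Z) \<le> ?M Z \<bullet> Z"
      using sylvester_op_ge[OF symM symP, of Z] unfolding a_def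
      by (simp only: power2_norm_eq_inner[symmetric] power2_eq_square)
    also have "\<dots> \<le> norm (?N Y) * norm Z" unfolding eq by (rule norm_cauchy_schwarz)
    finally have "norm Z * (a * norm Z) \<le> norm Z * norm (?N Y)" by (simp add: mult_ac)
    then have "a * norm Z \<le> norm (?N Y)"
      by (cases "Z = 0") auto
    also note Nle
    also have "?s * \<theta> * norm Y \<le> ?s * \<theta> ^ 3 * norm Y"
      using s \<theta>(1) power_increasing[of 1 3 \<theta>] by (intro mult_right_mono mult_left_mono) auto
    finally show ?thesis
      using a by (simp add: msi_rho_def field_simps flip: \<theta>_def a_def)
  qed
qed

section \<open>Error propagation of the iteration\<close>

lemma sylvester_solutionI:
  assumes "\<exists>!X. M ** X + X ** P = R"
  shows "sylvester_op M P (sylvester_solution M P R) = R"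
  using theI'[OF assms] by (simp add: sylvester_op_def sylvester_solution_def)

text \<open>The exact solution is a fixed point of the half step, so subtracting the two equations
  cancels \<open>C\<close> and leaves a homogeneous relation between the errors.\<close>

lemma msi_half_step_contraction:
  fixes X Y :: "real^'m^'n"
  assumes split: "complex_eigenvalues A \<inter> complex_eigenvalues (- B) = {}" "A = M - N" "B = P - Q"
    "sym_pos_def M" "sym_pos_def P"
    "symmetric_mat (sylvester_mat M P ** matrix_inv (sylvester_mat A B))"
    and X: "sylvester_op A B X = C"
  shows "norm (msi_half_step M N P Q C Y - X) \<le> msi_rho M N P Q * norm (Y - X)"
proof (rule splitting_contraction(2)[OF split])
  \<comment> \<open>Positive definiteness gives unique solvability, so the description operator
    behind the half step denotes an actual solution.\<close>
  have "Z = 0" if "sylvester_op M P Z = 0" for Z :: "real^'m^'n"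
    using sylvester_op_pos[OF split(4,5), of Z] that by auto
  then have "\<exists>!Z. M ** Z + Z ** P = N ** Y + Y ** Q + C"
    using linear_injective_ex1[OF linear_sylvester_op] unfolding sylvester_op_def by blast
  from sylvester_solutionI[OF this]
  have "sylvester_op M P (msi_half_step M N P Q C Y) = sylvester_op N Q Y + C"
    by (simp add: msi_half_step_def sylvester_op_def)
  moreover have "C = sylvester_op M P X - sylvester_op N Q X"
    using X unfolding split(2,3) by (simp add: sylvester_op_diff)
  ultimately show "sylvester_op M P (msi_half_step M N P Q C Y - X) = sylvester_op N Q (Y - X)"
    by (simp add: linear_diff[OF linear_sylvester_op])
qed

theorem theorem2p6:
  fixes A M1 N1 M2 N2 :: "real^'n^'n"
    and B P1 Q1 P2 Q2 :: "real^'m^'m"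
  assumes "complex_eigenvalues A \<inter> complex_eigenvalues (- B) = {}"
    and "A = M1 - N1" and "B = P1 - Q1"
    and "A = M2 - N2" and "B = P2 - Q2"
    and "sym_pos_def M1" and "sym_pos_def P1"
    and "sym_pos_def M2" and "sym_pos_def P2"
    and "symmetric_mat (sylvester_mat M1 P1 ** matrix_inv (sylvester_mat A B))"
    and "symmetric_mat (sylvester_mat M2 P2 ** matrix_inv (sylvester_mat A B))"
    and "sylvester_mat M1 P1 ** matrix_inv (sylvester_mat A B) ** sylvester_mat M2 P2
       = sylvester_mat M2 P2 ** matrix_inv (sylvester_mat A B) ** sylvester_mat M1 P1"
    and "msi_rho M1 N1 P1 Q1 * msi_rho M2 N2 P2 Q2 < 1"
  shows "\<forall>(C :: real^'m^'n) (X0 :: real^'m^'n).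
           (\<exists>!X. A ** X + X ** B = C) \<and>
           msi_iterate M1 N1 P1 Q1 M2 N2 P2 Q2 C X0 \<longlonglongrightarrow> sylvester_solution A B C"
proof (intro allI)
  fix C X0 :: "real^'m^'n"
  let ?r1 = "msi_rho M1 N1 P1 Q1" and ?r2 = "msi_rho M2 N2 P2 Q2"
  let ?X = "sylvester_solution A B C"
  let ?it = "msi_iterate M1 N1 P1 Q1 M2 N2 P2 Q2 C X0"
  note split1 = assms(1-3,6,7,10) and split2 = assms(1,4,5,8,9,11)
  have ex1: "\<exists>!X. A ** X + X ** B = C"
    using linear_injective_ex1[OF linear_sylvester_op sylvester_op_eq_0[OF assms(1)]]
    by (simp add: sylvester_op_def)
  note X = sylvester_solutionI[OF ex1]
  have r: "?r1 \<ge> 0" "?r2 \<ge> 0"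
    using splitting_contraction(1)[OF split1] splitting_contraction(1)[OF split2] by auto
  \<comment> \<open>Both half steps share the fixed point \<open>?X\<close>, so a full step shrinks
    the error by the product of the factors, even if one of them exceeds 1.\<close>
  have "norm (?it k - ?X) \<le> (?r1 * ?r2) ^ k * norm (X0 - ?X)" for k
  proof (induction k)
    case (Suc k)
    let ?U = "msi_half_step M1 N1 P1 Q1 C (?it k)"
    have "norm (?it (Suc k) - ?X) \<le> ?r2 * norm (?U - ?X)"
      using msi_half_step_contraction[OF split2 X] by (simp add: Let_def)
    also have "\<dots> \<le> ?r2 * (?r1 * norm (?it k - ?X))"
      using msi_half_step_contraction[OF split1 X] r by (intro mult_left_mono)
    also have "\<dots> \<le> ?r2 * (?r1 * ((?r1 * ?r2) ^ k * norm (X0 - ?X)))"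
      using Suc r by (intro mult_left_mono)
    finally show ?case by (simp add: mult_ac)
  qed simp
  moreover have "(\<lambda>k. (?r1 * ?r2) ^ k * norm (X0 - ?X)) \<longlonglongrightarrow> 0"
    using r assms(13) by (intro tendsto_mult_left_zero LIMSEQ_power_zero) auto
  ultimately have "(\<lambda>k. ?it k - ?X) \<longlonglongrightarrow> 0"
    by (intro Lim_null_comparison[of "\<lambda>k. ?it k - ?X"]) auto
  then show "(\<exists>!X. A ** X + X ** B = C) \<and> ?it \<longlonglongrightarrow> ?X"
    using ex1 LIM_zero_cancel by blast
qed

end
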